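(* Let $k\ge 2$ and $d\ge 1$ be integers. Then for all sufficiently large $n$ there exists a partition $\{B^1,\dots,B^m\}$ of $[n]^d$ into proper boxes having the $k$-piercing property with $m\le 15^{d/2}k$.
   Context: $[n]=\{1,\dots,n\}$. A box in $[n]^d$ (sub-box) is a set $B=B_1\times\cdots\times B_d$ with $B_i\subseteq[n]$ (arbitrary subsets, not necessarily intervals); it is proper if $B_i\neq[n]$ for every $i$. An axis-parallel line in $[n]^d$ is a set of the form $\{x\in[n]^d : x_j=c_j \text{ for all } j\neq i\}$ for some $i\in[d]$ and fixed $c_j\in[n]$. A partition $\{B^1,\dots,B^m\}$ of $[n]^d$ has the $k$-piercing property if every axis-parallel line intersects at least $k$ distinct $B^j$. *)

theory Defs
  imports Complex_Main "HOL-Library.FuncSet" "HOL-Library.Disjoint_Sets"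
begin

text \<open>Points of \<open>[n]^d\<close> are functions on the coordinate set \<open>{1..d}\<close>, set to \<open>undefined\<close> elsewhere.\<close>

definition grid :: "nat \<Rightarrow> nat \<Rightarrow> (nat \<Rightarrow> nat) set" where
  "grid n d = {1..d} \<rightarrow>\<^sub>E {1..n}"

text \<open>The sides of a nonempty box are determined by the box; only the empty box has several
  representations, and it is never a block of a partition (\<^const>\<open>partition_on\<close>).\<close>

definition proper_box :: "nat \<Rightarrow> nat \<Rightarrow> (nat \<Rightarrow> nat) set \<Rightarrow> bool" where
  "proper_box n d B \<longleftrightarrow>
     (\<exists>S. (\<forall>i\<in>{1..d}. S i \<subseteq> {1..n} \<and> S i \<noteq> {1..n}) \<and> B = Pi\<^sub>E {1..d} S)"

definition axis_line :: "nat \<Rightarrow> nat \<Rightarrow> (nat \<Rightarrow> nat) set \<Rightarrow> bool" where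
  "axis_line n d L \<longleftrightarrow>
     (\<exists>i\<in>{1..d}. \<exists>c. (\<forall>j\<in>{1..d} - {i}. c j \<in> {1..n}) \<and>
        L = {x \<in> grid n d. \<forall>j\<in>{1..d} - {i}. x j = c j})"

definition piercing :: "nat \<Rightarrow> nat \<Rightarrow> nat \<Rightarrow> (nat \<Rightarrow> nat) set set \<Rightarrow> bool" where
  "piercing k n d P \<longleftrightarrow> (\<forall>L. axis_line n d L \<longrightarrow> k \<le> card {B \<in> P. B \<inter> L \<noteq> {}})"

end

theory Submission
  imports Defs
begin

text \<open>
  It suffices to partition the grid into at most \<open>15\<^bsup>d/2\<^esup>\<close> blocks, each of them cut into \<open>k\<close>
  parallel strips, so that every line crosses all strips of some block. This is done by induction in
  steps of two dimensions. Cut the blocks in dimension \<open>d\<close> into \<open>3k\<close> strips, and let the three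
  groups of \<open>k\<close> consecutive strips be the types \<open>0, 1, 2\<close>. Over type \<open>t\<close>, divide the plane of the
  two new coordinates by a pinwheel (a central box surrounded by four arms). The centre keeps the
  \<open>k\<close> old strips, and the arms are cut into \<open>k\<close> strips along the new coordinates, two arms for each
  of them; already the arms serve all lines in the new directions. The three centres are chosen so
  that they cover the plane, so for a line in an old direction one of the types will do. Every block
  gives rise to \<open>3 \<cdot> 5 = 15\<close> new ones.
\<close>

section \<open>Boxes and strip labellings\<close>

text \<open>The flag \<open>c\<close> makes the empty set a box also in dimension \<open>0\<close>.\<close>

definition box_pred :: "nat \<Rightarrow> ((nat \<Rightarrow> nat) \<Rightarrow> bool) \<Rightarrow> bool" where
  "box_pred d P \<longleftrightarrow> (\<exists>c A. \<forall>x. P x \<longleftrightarrow> c \<and> (\<forall>i\<in>{1..d}. x i \<in> A i))"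

text \<open>The label of a point consists of the index of its block and the index of its strip. The boxes
  required here include all unions of strips of a block.\<close>

definition strip_labelling :: "nat \<Rightarrow> nat \<Rightarrow> nat \<Rightarrow> nat \<Rightarrow> ((nat \<Rightarrow> nat) \<Rightarrow> nat \<times> nat) \<Rightarrow> bool" where
  "strip_labelling N k d M g \<longleftrightarrow>
     (\<forall>x. fst (g x) < M \<and> snd (g x) < k) \<and>
     (\<forall>b S. box_pred d (\<lambda>x. fst (g x) = b \<and> snd (g x) \<in> S)) \<and>
     (\<forall>x. \<forall>i\<in>{1..d}. \<exists>b. \<forall>p<k. \<exists>v\<in>{1..N}. g (x(i := v)) = (b, p))"

lemma strip_labelling_bounds:
  assumes "strip_labelling N k d M g"
  shows "fst (g x) < M" "snd (g x) < k"
  using assms by (simp_all add: strip_labelling_def)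

lemma strip_labelling_box:
  assumes "strip_labelling N k d M g"
  shows "box_pred d (\<lambda>x. fst (g x) = b \<and> snd (g x) \<in> S)"
  using assms by (simp add: strip_labelling_def)

lemma strip_labelling_line:
  assumes "strip_labelling N k d M g" "i \<in> {1..d}"
  obtains b where "\<And>p. p < k \<Longrightarrow> \<exists>v\<in>{1..N}. g (x(i := v)) = (b, p)"
  using assms unfolding strip_labelling_def by meson

lemma box_pred_cong: "(\<And>x. P x \<longleftrightarrow> Q x) \<Longrightarrow> box_pred d P \<longleftrightarrow> box_pred d Q"
  by (simp add: box_pred_def)

lemma box_pred_extend:
  assumes "box_pred d P"
  shows "box_pred (Suc (Suc d)) (\<lambda>x. P x \<and> x (Suc d) \<in> U \<and> x (Suc (Suc d)) \<in> V)"
proof -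
  from assms obtain c A where A: "\<And>x. P x \<longleftrightarrow> c \<and> (\<forall>i\<in>{1..d}. x i \<in> A i)"
    by (auto simp: box_pred_def)
  have "P x \<and> x (Suc d) \<in> U \<and> x (Suc (Suc d)) \<in> V \<longleftrightarrow>
    c \<and> (\<forall>i\<in>{1..Suc (Suc d)}. x i \<in> (A(Suc d := U, Suc (Suc d) := V)) i)" for x
    unfolding A by (auto simp: atLeastAtMostSuc_conv)
  then show ?thesis
    unfolding box_pred_def by blast
qed

section \<open>Residue classes and strips of one coordinate\<close>

text \<open>A coordinate enters a pinwheel through its class modulo 6; inside each class the remaining
  information serves to cut strips.\<close>

definition strip :: "nat \<Rightarrow> nat \<Rightarrow> nat" where
  "strip k u = u div 6 mod k"

lemma ex_class_strip:
  assumes "c < 6" "s < k"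
  shows "\<exists>v\<in>{1..12 * k}. v mod 6 = c \<and> strip k v = s"
proof -
  \<comment> \<open>Adding \<open>k\<close> keeps the strip, which is read modulo \<open>k\<close>,
    and makes \<open>v\<close> positive even for \<open>c = s = 0\<close>; the largest value is
    \<open>12 * k - 1\<close>.\<close>
  define v where "v = c + 6 * (s + k)"
  have "v mod 6 = c"
    unfolding v_def using assms(1) by (simp only: mod_mult_self2 mod_less)
  moreover have "v div 6 = s + k"
    unfolding v_def using assms(1) by (simp only: div_mult_self2 div_less)
  then have "strip k v = s"
    using assms(2) by (simp add: strip_def)
  moreover have "v \<in> {1..12 * k}"
    unfolding v_def using assms by simp
  ultimately show ?thesis
    by blast
qed

section \<open>The pinwheel\<close>

text \<open>The pinwheel has the centre \<open>4\<close>, the arms \<open>0\<close> and \<open>2\<close>, which are narrow in the first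
  coordinate, and the arms \<open>1\<close> and \<open>3\<close>, which are narrow in the second one.\<close>

definition pinwheel :: "'a \<Rightarrow> 'a \<Rightarrow> 'a \<Rightarrow> 'a \<Rightarrow> nat" where
  "pinwheel p q a b =
    (if a = p \<and> b \<noteq> q then 0
     else if b = q \<and> a \<noteq> q then 1
     else if a = q \<and> b \<noteq> p then 2
     else if b = p \<and> a \<noteq> p then 3
     else 4)"

lemma pinwheel_less: "pinwheel p q a b < 5"
  by (cases "a = p"; cases "a = q"; cases "b = p"; cases "b = q") (simp_all add: pinwheel_def)

text \<open>For \<open>p \<noteq> q\<close> the arm conditions exclude each other, each arm taking
  one of the four corners with coordinates in \<open>{p, q}\<close>. So every arm is the product its
  own test describes, and the centre is what remains.\<close>

lemma pinwheel_fibre: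
  assumes "p \<noteq> q"
  shows "\<exists>U V. \<forall>a b. pinwheel p q a b = e \<longleftrightarrow> a \<in> U \<and> b \<in> V"
proof -
  have arms: "pinwheel p q a b = 0 \<longleftrightarrow> a \<in> {p} \<and> b \<in> - {q}"
    "pinwheel p q a b = 1 \<longleftrightarrow> a \<in> - {q} \<and> b \<in> {q}"
    "pinwheel p q a b = 2 \<longleftrightarrow> a \<in> {q} \<and> b \<in> - {p}"
    "pinwheel p q a b = 3 \<longleftrightarrow> a \<in> - {p} \<and> b \<in> {p}"
    "pinwheel p q a b = 4 \<longleftrightarrow> a \<in> - {p, q} \<and> b \<in> - {p, q}" for a b
    using assms
    by (cases "a = p"; cases "a = q"; cases "b = p"; cases "b = q"; simp add: pinwheel_def)+
  show ?thesis
  proof (cases "e < 5")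
    case True
    then have "e = 0 \<or> e = 1 \<or> e = 2 \<or> e = 3 \<or> e = 4"
      by (simp add: less_Suc_eq numeral_eq_Suc)
    then show ?thesis
      by (elim disjE; hypsubst) (intro exI allI, rule arms)+
  next
    case False
    then have "pinwheel p q a b = e \<longleftrightarrow> a \<in> {} \<and> b \<in> {}" for a b
      using pinwheel_less[of p q a b] by auto
    then show ?thesis
      by (intro exI allI)
  qed
qed

lemma pinwheel_centre: "a \<notin> {p, q} \<Longrightarrow> b \<notin> {p, q} \<Longrightarrow> pinwheel p q a b = 4"
  by (simp add: pinwheel_def)

text \<open>In their columns, arm \<open>0\<close> lacks only height \<open>q\<close> and arm
  \<open>2\<close> only height \<open>p\<close>, so every horizontal line crosses one of
  them.\<close>

lemma pinwheel_arm_fst: "p \<noteq> q \<Longrightarrow> \<exists>a\<in>{p, q}. pinwheel p q a b \<in> {0, 2}"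
  by (auto simp: pinwheel_def)

lemma pinwheel_arm_snd: "p \<noteq> q \<Longrightarrow> \<exists>b\<in>{p, q}. pinwheel p q a b \<in> {1, 3}"
  by (auto simp: pinwheel_def)

text \<open>The pairs \<open>{2 * t, 2 * t + 1}\<close> are disjoint, so \<open>a\<close> and
  \<open>b\<close> each rule out at most one of the three types.\<close>

lemma pinwheel_centres_cover: "\<exists>t<3. pinwheel (2 * t) (2 * t + 1) (a::nat) b = 4"
proof -
  have "\<exists>t<3. t \<noteq> a div 2 \<and> t \<noteq> b div 2"
  proof (rule ccontr)
    assume "\<not> ?thesis"
    then have "t \<in> {a div 2, b div 2}" if "t < 3" for t
      using that by blast
    then have "{..<3} \<subseteq> {a div 2, b div 2}"
      by blast
    then have "card {..<3 :: nat} \<le> card {a div 2, b div 2}"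
      by (intro card_mono) auto
    also have "\<dots> \<le> 2"
      by (simp add: card_insert_if)
    finally show False
      by simp
  qed
  then obtain t where t: "t < 3" "t \<noteq> a div 2" "t \<noteq> b div 2"
    by blast
  have "c \<notin> {2 * t, 2 * t + 1}" if "t \<noteq> c div 2" for c
    using that by auto
  with t show ?thesis
    by (metis pinwheel_centre)
qed

definition pinwheel_at :: "nat \<Rightarrow> nat \<Rightarrow> (nat \<Rightarrow> nat) \<Rightarrow> nat" where
  "pinwheel_at d t x = pinwheel (2 * t) (2 * t + 1) (x (Suc d) mod 6) (x (Suc (Suc d)) mod 6)"

lemma pinwheel_at_less: "pinwheel_at d t x < 5"
  by (simp add: pinwheel_at_def pinwheel_less)

section \<open>Adding two coordinates\<close>

text \<open>The labelling \<open>g\<close> of the first \<open>d\<close> coordinates has \<open>3k\<close> strips per block.\<close>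

definition refine :: "nat \<Rightarrow> nat \<Rightarrow> ((nat \<Rightarrow> nat) \<Rightarrow> nat \<times> nat) \<Rightarrow> (nat \<Rightarrow> nat) \<Rightarrow> nat \<times> nat" where
  "refine k d g x =
    (let b = fst (g x); p = snd (g x); t = p div k; e = pinwheel_at d t x
     in (15 * b + 5 * t + e,
         if e = 4 then p mod k
         else if e \<in> {0, 2} then strip k (x (Suc d)) else strip k (x (Suc (Suc d)))))"

lemma block_code_eq_iff:
  fixes t t' e e' :: nat
  assumes "t < 3" "t' < 3" "e < 5" "e' < 5"
  shows "15 * b + 5 * t + e = 15 * b' + 5 * t' + e' \<longleftrightarrow> b = b' \<and> t = t' \<and> e = e'"
proof
  assume *: "15 * b + 5 * t + e = 15 * b' + 5 * t' + e'"
  with assms have "b = b'"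
    by linarith
  moreover from this * assms have "t = t'"
    by linarith
  ultimately show "b = b' \<and> t = t' \<and> e = e'"
    using * by simp
qed simp

text \<open>A new block fixes the old block, the type and the pinwheel piece. The type restricts
  only the old strip, and old boxes allow any set of strips; the piece is a product in the new
  coordinates. The new strip depends on the old strip alone or on a single new coordinate, so one
  factor absorbs \<open>S\<close>.\<close>

lemma box_pred_refine:
  assumes g: "strip_labelling N (3 * k) d M g"
  shows "box_pred (Suc (Suc d)) (\<lambda>x. fst (refine k d g x) = B \<and> snd (refine k d g x) \<in> S)"
proof -
  define b t e where "b = B div 15" and "t = B mod 15 div 5" and "e = B mod 5"
  have t: "t < 3" and e: "e < 5"
    by (simp_all add: t_def e_def less_mult_imp_div_less)
  have "e = B mod 15 mod 5"
    by (simp add: e_def mod_mod_cancel)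
  then have "5 * t + e = B mod 15"
    by (simp add: t_def)
  then have B: "B = 15 * b + 5 * t + e"
    using mult_div_mod_eq[of 15 B] unfolding b_def by linarith
  have tx: "snd (g x) div k < 3" for x
    using strip_labelling_bounds[OF g] by (simp add: less_mult_imp_div_less)
  have fst: "fst (refine k d g x) = B \<longleftrightarrow>
      fst (g x) = b \<and> snd (g x) div k = t \<and> pinwheel_at d t x = e" for x
    unfolding B using block_code_eq_iff[OF tx t pinwheel_at_less e]
    by (auto simp: refine_def Let_def)
  have snd: "snd (refine k d g x) = (if e = 4 then snd (g x) mod k
      else if e \<in> {0, 2} then strip k (x (Suc d)) else strip k (x (Suc (Suc d))))"
    if "snd (g x) div k = t" "pinwheel_at d t x = e" for x
    using that by (simp add: refine_def Let_def)
  obtain U V where "\<And>a b. pinwheel (2 * t) (2 * t + 1) a b = e \<longleftrightarrow> a \<in> U \<and> b \<in> V"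
    using pinwheel_fibre[of "2 * t" "2 * t + 1" e] by auto
  then have UV: "pinwheel_at d t x = e \<longleftrightarrow> x (Suc d) mod 6 \<in> U \<and> x (Suc (Suc d)) mod 6 \<in> V" for x
    by (simp add: pinwheel_at_def)
  have old: "box_pred d (\<lambda>x. fst (g x) = b \<and> snd (g x) \<in> T)" for T
    by (rule strip_labelling_box[OF g])
  have *: "fst (refine k d g x) = B \<and> snd (refine k d g x) \<in> S \<longleftrightarrow>
      fst (g x) = b \<and> snd (g x) div k = t \<and> x (Suc d) mod 6 \<in> U \<and> x (Suc (Suc d)) mod 6 \<in> V \<and>
      (if e = 4 then snd (g x) mod k
       else if e \<in> {0, 2} then strip k (x (Suc d)) else strip k (x (Suc (Suc d)))) \<in> S" for x
  proof (cases "snd (g x) div k = t \<and> pinwheel_at d t x = e")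
    case True
    then have te: "snd (g x) div k = t" "pinwheel_at d t x = e"
      by blast+
    then show ?thesis
      unfolding fst snd[OF te] UV by blast
  next
    case False
    then show ?thesis
      unfolding fst UV by blast
  qed
  consider "e = 4" | "e \<noteq> 4" "e \<in> {0, 2}" | "e \<noteq> 4" "e \<notin> {0, 2}"
    by blast
  then show ?thesis
  proof cases
    case 1
    show ?thesis
      by (rule iffD2[OF box_pred_cong box_pred_extend[OF old[of "{p. p div k = t \<and> p mod k \<in> S}"],
            of "{u. u mod 6 \<in> U}" "{u. u mod 6 \<in> V}"]])
        (unfold * if_P[OF 1], blast)
  next
    case 2
    show ?thesis
      by (rule iffD2[OF box_pred_cong box_pred_extend[OF old[of "{p. p div k = t}"],
            of "{u. u mod 6 \<in> U \<and> strip k u \<in> S}" "{u. u mod 6 \<in> V}"]])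
        (unfold * if_not_P[OF 2(1)] if_P[OF 2(2)], blast)
  next
    case 3
    show ?thesis
      by (rule iffD2[OF box_pred_cong box_pred_extend[OF old[of "{p. p div k = t}"],
            of "{u. u mod 6 \<in> U}" "{u. u mod 6 \<in> V \<and> strip k u \<in> S}"]])
        (unfold * if_not_P[OF 3(1)] if_not_P[OF 3(2)], blast)
  qed
qed

text \<open>The points sharing the label of \<open>x\<close> form a box that restricts only the
  first \<open>d\<close> coordinates.\<close>

lemma strip_labelling_upd:
  assumes "strip_labelling N k d M g" and "j > d"
  shows "g (x(j := v)) = g x"
proof -
  have "box_pred d (\<lambda>y. fst (g y) = fst (g x) \<and> snd (g y) \<in> {snd (g x)})"
    by (rule strip_labelling_box[OF assms(1)])
  then obtain c A where A: "\<And>y. fst (g y) = fst (g x) \<and> snd (g y) \<in> {snd (g x)} \<longleftrightarrow>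
      c \<and> (\<forall>i\<in>{1..d}. y i \<in> A i)"
    by (auto simp: box_pred_def)
  have "c \<and> (\<forall>i\<in>{1..d}. x i \<in> A i)"
    using A[of x] by simp
  then have "c \<and> (\<forall>i\<in>{1..d}. (x(j := v)) i \<in> A i)"
    using assms(2) by simp
  then show ?thesis
    using A[of "x(j := v)"] by (simp add: prod_eq_iff)
qed

lemma strip_labelling_refine:
  assumes g: "strip_labelling N (3 * k) d M g" and k: "k > 0"
  shows "strip_labelling (max N (12 * k)) k (Suc (Suc d)) (15 * M) (refine k d g)"
  unfolding strip_labelling_def
proof (intro conjI allI ballI)
  have gx: "fst (g x) < M" "snd (g x) div k < 3" for x
    using strip_labelling_bounds[OF g] by (simp_all add: less_mult_imp_div_less)
  show "fst (refine k d g x) < 15 * M" for x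
    using gx[of x] pinwheel_at_less[of d "snd (g x) div k" x]
    by (simp add: refine_def Let_def)
  show "snd (refine k d g x) < k" for x
    using k by (simp add: refine_def Let_def strip_def)
  show "box_pred (Suc (Suc d)) (\<lambda>x. fst (refine k d g x) = B \<and> snd (refine k d g x) \<in> S)" for B S
    using box_pred_refine[OF g] .
  fix x i assume "i \<in> {1..Suc (Suc d)}"
  then consider "i \<in> {1..d}" | "i = Suc d" | "i = Suc (Suc d)"
    by force
  then show "\<exists>b. \<forall>p<k. \<exists>v\<in>{1..max N (12 * k)}. refine k d g (x(i := v)) = (b, p)"
  proof cases
    case 1
    obtain b where b: "\<And>p. p < 3 * k \<Longrightarrow> \<exists>v\<in>{1..N}. g (x(i := v)) = (b, p)"
      using strip_labelling_line[OF g 1] by blast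
    \<comment> \<open>The new coordinates stay fixed on the line, so some type has its centre over
      them; its old strips \<open>t * k + p\<close> become the strips \<open>p\<close> of one
      block.\<close>
    obtain t where t: "t < 3" "pinwheel_at d t x = 4"
      using pinwheel_centres_cover unfolding pinwheel_at_def by blast
    have "\<exists>v\<in>{1..max N (12 * k)}. refine k d g (x(i := v)) = (15 * b + 5 * t + 4, p)" if "p < k" for p
    proof -
      have "t * k \<le> 2 * k"
        using t by (intro mult_right_mono) auto
      then have "t * k + p < 3 * k"
        using that by linarith
      then obtain v where "v \<in> {1..N}" "g (x(i := v)) = (b, t * k + p)"
        using b by blast
      moreover have "pinwheel_at d t (x(i := v)) = 4"
        using t(2) 1 by (simp add: pinwheel_at_def)
      ultimately show ?thesis
        using \<open>p < k\<close> by (intro bexI[of _ v]) (auto simp: refine_def)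
    qed
    then show ?thesis
      by blast
  next
    case 2
    \<comment> \<open>Changing a new coordinate keeps \<open>g x\<close>, hence the type. Some class
      \<open>a\<close> leads into an arm cut along this coordinate, and the members of that class
      realize all strips.\<close>
    define t where "t = snd (g x) div k"
    have t: "t < 3"
      using gx(2) by (simp add: t_def)
    obtain a where "a \<in> {2 * t, 2 * t + 1}"
      and a2: "pinwheel (2 * t) (2 * t + 1) a (x (Suc (Suc d)) mod 6) \<in> {0, 2}"
      using pinwheel_arm_fst[of "2 * t" "2 * t + 1"] by force
    then have a: "a < 6"
      using t by auto
    define e where "e = pinwheel (2 * t) (2 * t + 1) a (x (Suc (Suc d)) mod 6)"
    have "\<exists>v\<in>{1..max N (12 * k)}.
        refine k d g (x(i := v)) = (15 * fst (g x) + 5 * t + e, p)" if p: "p < k" for p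
    proof -
      obtain v where v: "v \<in> {1..12 * k}" "v mod 6 = a" "strip k v = p"
        using ex_class_strip[OF a p] by blast
      have "pinwheel_at d t (x(i := v)) = e"
        using v by (simp add: 2 pinwheel_at_def e_def)
      then have "refine k d g (x(i := v)) = (15 * fst (g x) + 5 * t + e, p)"
        using v a2[folded e_def] unfolding refine_def Let_def
        by (auto simp: 2 strip_labelling_upd[OF g] t_def[symmetric])
      with v show ?thesis
        by (intro bexI[of _ v]) auto
    qed
    then show ?thesis
      by blast
  next
    case 3
    \<comment> \<open>The mirror image: arms \<open>1\<close> and \<open>3\<close> are cut along the
      last coordinate.\<close>
    define t where "t = snd (g x) div k"
    have t: "t < 3"
      using gx(2) by (simp add: t_def)
    obtain a where "a \<in> {2 * t, 2 * t + 1}"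
      and a2: "pinwheel (2 * t) (2 * t + 1) (x (Suc d) mod 6) a \<in> {1, 3}"
      using pinwheel_arm_snd[of "2 * t" "2 * t + 1"] by force
    then have a: "a < 6"
      using t by auto
    define e where "e = pinwheel (2 * t) (2 * t + 1) (x (Suc d) mod 6) a"
    have "\<exists>v\<in>{1..max N (12 * k)}.
        refine k d g (x(i := v)) = (15 * fst (g x) + 5 * t + e, p)" if p: "p < k" for p
    proof -
      obtain v where v: "v \<in> {1..12 * k}" "v mod 6 = a" "strip k v = p"
        using ex_class_strip[OF a p] by blast
      have "pinwheel_at d t (x(i := v)) = e"
        using v by (simp add: 3 pinwheel_at_def e_def)
      then have "refine k d g (x(i := v)) = (15 * fst (g x) + 5 * t + e, p)"
        using v a2[folded e_def] unfolding refine_def Let_def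
        by (auto simp: 3 strip_labelling_upd[OF g] t_def[symmetric])
      with v show ?thesis
        by (intro bexI[of _ v]) auto
    qed
    then show ?thesis
      by blast
  qed
qed

section \<open>Low dimensions and the induction\<close>

lemma strip_labelling_1:
  assumes "k > 0"
  shows "strip_labelling (2 * k) k 1 1 (\<lambda>x. (0, x 1 mod k))"
  unfolding strip_labelling_def
proof (intro conjI allI ballI)
  fix b S
  show "box_pred 1 (\<lambda>x. fst (0, x 1 mod k) = b \<and> snd (0, x 1 mod k) \<in> S)"
    unfolding box_pred_def
    by (intro exI[of _ "0 = b"] exI[of _ "\<lambda>_. {v. v mod k \<in> S}"]) simp
next
  fix x :: "nat \<Rightarrow> nat" and i :: nat assume "i \<in> {1..1}"
  then have "i = 1"
    by simp
  \<comment> \<open>The value \<open>p\<close> itself would fail for \<open>p = 0\<close>, hence the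
    shift by \<open>k\<close>.\<close>
  have "\<exists>v\<in>{1..2 * k}. v mod k = p" if "p < k" for p
    using that by (intro bexI[of _ "p + k"]) auto
  then show "\<exists>b. \<forall>p<k. \<exists>v\<in>{1..2 * k}. (0, (x(i := v)) 1 mod k) = (b, p)"
    by (simp add: \<open>i = 1\<close>)
qed (use assms in auto)

text \<open>The step needs \<open>3 * k\<close> strips in dimension \<open>d\<close>, so
  \<open>k\<close> is generalized. Dimensions \<open>0\<close> and \<open>1\<close> take one block,
  and every two further dimensions cost a factor 15.\<close>

lemma ex_strip_labelling: "k > 0 \<Longrightarrow> \<exists>N g. strip_labelling N k d (15 ^ (d div 2)) g"
proof (induction d arbitrary: k rule: induct_nat_012)
  case 0
  have "box_pred 0 (\<lambda>x. fst (0::nat, 0::nat) = b \<and> snd (0::nat, 0::nat) \<in> S)" for b S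
    by (simp add: box_pred_def)
  then have "strip_labelling 0 k 0 1 (\<lambda>_. (0, 0))"
    using 0 by (simp add: strip_labelling_def)
  then show ?case
    by auto
next
  case 1
  then show ?case
    using strip_labelling_1[of k] by auto
next
  case (ge2 d)
  obtain N g where "strip_labelling N (3 * k) d (15 ^ (d div 2)) g"
    using ge2.IH(1)[of "3 * k"] ge2.prems by auto
  from strip_labelling_refine[OF this ge2.prems] show ?case
    by auto
qed

section \<open>From labellings to partitions\<close>

lemma partition_on_fibres: "partition_on A ((\<lambda>l. {x \<in> A. g x = l}) ` g ` A)"
  by (rule partition_onI) (auto simp: disjnt_def)

text \<open>The parts are the label fibres on the grid. Every line carries all \<open>k\<close>
  labels of some block, which gives piercing; as \<open>k \<ge> 2\<close>, no fibre contains a line,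
  which gives properness.\<close>

lemma strip_labelling_partition:
  assumes g: "strip_labelling N k d M g" and k: "k \<ge> 2" and n: "n \<ge> N"
  shows "\<exists>P. partition_on (grid n d) P \<and> (\<forall>B\<in>P. proper_box n d B) \<and> piercing k n d P \<and>
           card P \<le> M * k"
proof -
  let ?G = "grid n d"
  define fibre where "fibre l = {x \<in> ?G. g x = l}" for l
  define P where "P = fibre ` g ` ?G"
  have im: "g ` ?G \<subseteq> {..<M} \<times> {..<k}"
    using strip_labelling_bounds[OF g] by (simp add: image_subset_iff mem_Times_iff)
  then have fin: "finite (g ` ?G)"
    by (rule finite_subset) auto
  have "card P \<le> card (g ` ?G)"
    unfolding P_def using fin by (rule card_image_le)
  also have "\<dots> \<le> M * k"
    using card_mono[OF _ im] by simp
  finally have card: "card P \<le> M * k" .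
  have hit: "\<exists>b. \<forall>p<k. \<exists>v\<in>{1..n}. g (x(i := v)) = (b, p)" if i: "i \<in> {1..d}" for x i
  proof -
    obtain b where b: "\<And>p. p < k \<Longrightarrow> \<exists>v\<in>{1..N}. g (x(i := v)) = (b, p)"
      using strip_labelling_line[OF g i] by blast
    have "\<exists>v\<in>{1..n}. g (x(i := v)) = (b, p)" if "p < k" for p
      using b[OF that] n by fastforce
    then show ?thesis
      by blast
  qed
  have "proper_box n d (fibre (g x))" if x: "x \<in> ?G" for x
  proof -
    have "box_pred d (\<lambda>y. fst (g y) = fst (g x) \<and> snd (g y) \<in> {snd (g x)})"
      by (rule strip_labelling_box[OF g])
    then obtain c A where "\<And>y. fst (g y) = fst (g x) \<and> snd (g y) \<in> {snd (g x)} \<longleftrightarrow>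
        c \<and> (\<forall>i\<in>{1..d}. y i \<in> A i)"
      by (auto simp: box_pred_def)
    then have *: "g y = g x \<longleftrightarrow> c \<and> (\<forall>i\<in>{1..d}. y i \<in> A i)" for y
      by (simp add: prod_eq_iff)
    have "c" and xA: "\<And>i. i \<in> {1..d} \<Longrightarrow> x i \<in> A i"
      using *[of x] by auto
    define S where "S i = A i \<inter> {1..n}" for i
    have "fibre (g x) = Pi\<^sub>E {1..d} S"
      using \<open>c\<close> unfolding fibre_def * S_def grid_def set_eq_iff PiE_iff mem_Collect_eq by blast
    moreover have "S i \<noteq> {1..n}" if i: "i \<in> {1..d}" for i
    proof
      \<comment> \<open>A full side would make \<open>g\<close> constant on the line through
        \<open>x\<close> in direction \<open>i\<close>, against the labels \<open>(b, 0)\<close> and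
        \<open>(b, 1)\<close> found there.\<close>
      assume "S i = {1..n}"
      then have "{1..n} \<subseteq> A i"
        by (auto simp: S_def)
      then have same: "g (x(i := v)) = g x" if "v \<in> {1..n}" for v
        using that xA \<open>c\<close> by (auto simp: *)
      obtain b where b: "\<forall>p<k. \<exists>v\<in>{1..n}. g (x(i := v)) = (b, p)"
        using hit[OF i] by blast
      have "g x = (b, p)" if "p < k" for p
        using b that same by metis
      from this[of 0] this[of 1] show False
        using k by simp
    qed
    ultimately show ?thesis
      unfolding proper_box_def by (intro exI[of _ S]) (auto simp: S_def)
  qed
  then have proper: "\<forall>B\<in>P. proper_box n d B"
    by (auto simp: P_def)
  have "k \<le> card {B \<in> P. B \<inter> L \<noteq> {}}" if "axis_line n d L" for L
  proof -
    from that obtain i c where i: "i \<in> {1..d}" and c: "\<forall>j\<in>{1..d} - {i}. c j \<in> {1..n}"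
      and L: "L = {x \<in> ?G. \<forall>j\<in>{1..d} - {i}. x j = c j}"
      unfolding axis_line_def by auto
    \<comment> \<open>\<open>restrict\<close> supplies the default value outside
      \<open>{1..d}\<close> that the grid demands; coordinate \<open>i\<close> is overwritten in
      \<open>xL\<close>.\<close>
    define x where "x = restrict c {1..d}"
    have xL: "x(i := v) \<in> L" if "v \<in> {1..n}" for v
      using that i c by (auto simp: L x_def grid_def PiE_iff extensional_def)
    obtain b where b: "\<forall>p<k. \<exists>v\<in>{1..n}. g (x(i := v)) = (b, p)"
      using hit[OF i] by blast
    have wit: "\<exists>y\<in>L. g y = (b, p)" if "p < k" for p
      using b that xL by metis
    have LG: "L \<subseteq> ?G"
      by (auto simp: L)
    \<comment> \<open>Distinct labels have disjoint fibres, but empty ones would coincide;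
      \<open>wit\<close> makes these nonempty.\<close>
    have "inj_on (\<lambda>p. fibre (b, p)) {..<k}"
    proof (rule inj_onI)
      fix p q assume "p \<in> {..<k}" and eq: "fibre (b, p) = fibre (b, q)"
      then obtain y where y: "y \<in> fibre (b, p)"
        using wit LG by (fastforce simp: fibre_def)
      moreover have "y \<in> fibre (b, q)"
        using y unfolding eq .
      ultimately have "(b, p) = (b, q)"
        by (simp add: fibre_def)
      then show "p = q"
        by simp
    qed
    then have "k = card ((\<lambda>p. fibre (b, p)) ` {..<k})"
      by (simp add: card_image)
    also have "\<dots> \<le> card {B \<in> P. B \<inter> L \<noteq> {}}"
    proof (rule card_mono)
      show "finite {B \<in> P. B \<inter> L \<noteq> {}}"
        using fin by (simp add: P_def)
      show "(\<lambda>p. fibre (b, p)) ` {..<k} \<subseteq> {B \<in> P. B \<inter> L \<noteq> {}}"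
      proof clarify
        fix p assume "p < k"
        then obtain y where y: "y \<in> L" "g y = (b, p)"
          using wit by blast
        then have "y \<in> fibre (b, p) \<inter> L" "(b, p) \<in> g ` ?G"
          using LG by (auto simp: fibre_def image_iff intro!: bexI[of _ y])
        then show "fibre (b, p) \<in> P \<and> fibre (b, p) \<inter> L \<noteq> {}"
          by (auto simp: P_def)
      qed
    qed
    finally show ?thesis .
  qed
  then have "piercing k n d P"
    by (simp add: piercing_def)
  moreover have "partition_on ?G P"
    unfolding P_def fibre_def by (rule partition_on_fibres)
  ultimately show ?thesis
    using proper card by blast
qed

theorem theorem1p6:
  fixes k d :: nat
  assumes "k \<ge> 2" and "d \<ge> 1"
  shows "\<forall>\<^sub>F n :: nat in sequentially.
    \<exists>P. partition_on (grid n d) P \<and> (\<forall>B\<in>P. proper_box n d B) \<and> piercing k n d P \<and>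
        real (card P) \<le> 15 powr (real d / 2) * real k"
proof -
  obtain N g where g: "strip_labelling N k d (15 ^ (d div 2)) g"
    using ex_strip_labelling[of k d] assms(1) by auto
  \<comment> \<open>For odd \<open>d\<close> the rounding leaves a factor \<open>sqrt 15\<close> to
    spare.\<close>
  have "real (d div 2) \<le> real d / 2"
    by linarith
  then have "15 powr real (d div 2) \<le> 15 powr (real d / 2)"
    by (intro powr_mono) auto
  then have bound: "(15::real) ^ (d div 2) \<le> 15 powr (real d / 2)"
    by (simp add: powr_realpow)
  show ?thesis
  proof (rule eventually_sequentiallyI)
    fix n assume "N \<le> n"
    then obtain P where P: "partition_on (grid n d) P" "\<forall>B\<in>P. proper_box n d B" "piercing k n d P"
      and "card P \<le> 15 ^ (d div 2) * k"
      using strip_labelling_partition[OF g assms(1)] by blast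
    from this(4) have "real (card P) \<le> real (15 ^ (d div 2) * k)"
      by (rule of_nat_mono)
    also have "\<dots> \<le> 15 powr (real d / 2) * real k"
      using bound by (simp add: mult_right_mono)
    finally show "\<exists>P. partition_on (grid n d) P \<and> (\<forall>B\<in>P. proper_box n d B) \<and> piercing k n d P \<and>
        real (card P) \<le> 15 powr (real d / 2) * real k"
      using P by blast
  qed
qed

end
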